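(* For every $n\ge 1$ there is a group isomorphism $\mathrm{TO}(2n)\cong M\rtimes \mathrm{Sp}(2n-2)$, where $M=\mathbb{F}_2^{2n-2}\oplus\mathbb{F}_2\ (=\mathbb{F}_2^{2n-1})$ is the representation of $\mathrm{Sp}(2n-2)$ given by $$A\cdot(v,\lambda)=\bigl(Av,\ q(v)+q(Av)+\lambda\bigr),\qquad A\in \mathrm{Sp}(2n-2),\ v\in\mathbb{F}_2^{2n-2},\ \lambda\in\mathbb{F}_2,$$ with $q([x_1,y_1,\ldots,x_{n-1},y_{n-1}])=x_1y_1+\cdots+x_{n-1}y_{n-1}$.
   Context: $\mathrm{TO}(2n)$ is the group of $2n\times 2n$ matrices $A$ over $\mathbb{F}_2$ with $AA^T=\mathrm{Id}$. $\mathrm{Sp}(2r)$ is the group of $2r\times 2r$ matrices over $\mathbb{F}_2$ preserving the bilinear form on $\mathbb{F}_2^{2r}$ (coordinates $[x_1,y_1,\ldots,x_r,y_r]$) given by $b([x,y],[x',y'])=\sum_i (x_iy_i'+y_ix_i')$; $\mathrm{Sp}(0)$ is trivial. For $A\in\mathrm{Sp}(2r)$ the function $v\mapsto q(v)+q(Av)$ is linear, and the displayed formula defines a linear action. The semidirect product has multiplication $(x,A)(y,B)=(x+A\cdot y,AB)$. *)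

theory Defs
  imports
    "HOL-Library.Z2"
    "HOL-Algebra.Group"
    "Jordan_Normal_Form.Determinant"
begin

text \<open>The field \<open>\<F>\<^sub>2\<close> is the type \<^typ>\<open>bit\<close>.\<close>

definition TO :: "nat \<Rightarrow> bit mat monoid" where
  "TO m = \<lparr>carrier = {A \<in> carrier_mat m m. A * A\<^sup>T = 1\<^sub>m m}, mult = (*), one = 1\<^sub>m m\<rparr>"

text \<open>
  A vector \<open>[x\<^sub>1, y\<^sub>1, \<dots>, x\<^sub>r, y\<^sub>r]\<close> of \<open>\<F>\<^sub>2\<close>-dimension \<open>2r\<close> is indexed from \<open>0\<close>, so
  \<open>x\<^sub>i\<close> and \<open>y\<^sub>i\<close> sit at positions \<open>2 (i - 1)\<close> and \<open>2 (i - 1) + 1\<close>.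
\<close>

definition symp_form :: "nat \<Rightarrow> bit vec \<Rightarrow> bit vec \<Rightarrow> bit" where
  "symp_form r v w = (\<Sum>i<r. v $ (2*i) * w $ (2*i+1) + v $ (2*i+1) * w $ (2*i))"

definition quad_form :: "nat \<Rightarrow> bit vec \<Rightarrow> bit" where
  "quad_form r v = (\<Sum>i<r. v $ (2*i) * v $ (2*i+1))"

text \<open>The argument is the rank: \<open>Sp r\<close> consists of matrices of size \<open>2r\<close>.\<close>

definition Sp :: "nat \<Rightarrow> bit mat monoid" where
  "Sp r = \<lparr>carrier = {A \<in> carrier_mat (2*r) (2*r).
              \<forall>v\<in>carrier_vec (2*r). \<forall>w\<in>carrier_vec (2*r).
                symp_form r (A *\<^sub>v v) (A *\<^sub>v w) = symp_form r v w},
           mult = (*), one = 1\<^sub>m (2*r)\<rparr>"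

definition M :: "nat \<Rightarrow> (bit vec \<times> bit) monoid" where
  "M r = monoid_vec TYPE(bit) (2*r) \<times>\<times> \<lparr>carrier = UNIV, mult = (+), one = 0\<rparr>"

definition M_action :: "nat \<Rightarrow> bit mat \<Rightarrow> bit vec \<times> bit \<Rightarrow> bit vec \<times> bit" where
  "M_action r A = (\<lambda>(v, l). (A *\<^sub>v v, quad_form r v + quad_form r (A *\<^sub>v v) + l))"

definition semidirect_product ::
  "('a, 'm) monoid_scheme \<Rightarrow> ('b \<Rightarrow> 'a \<Rightarrow> 'a) \<Rightarrow> ('b, 'n) monoid_scheme \<Rightarrow> ('a \<times> 'b) monoid" where
  "semidirect_product N \<phi> H =
    \<lparr>carrier = carrier N \<times> carrier H,
     mult = (\<lambda>(x, g) (y, h). (x \<otimes>\<^bsub>N\<^esub> \<phi> g y, g \<otimes>\<^bsub>H\<^esub> h)),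
     one = (\<one>\<^bsub>N\<^esub>, \<one>\<^bsub>H\<^esub>)\<rparr>"

lemma group_TO: "group (TO m)"
proof (rule groupI)
  fix A B assume "A \<in> carrier (TO m)" "B \<in> carrier (TO m)"
  then have A: "A \<in> carrier_mat m m" "A * A\<^sup>T = 1\<^sub>m m"
    and B: "B \<in> carrier_mat m m" "B * B\<^sup>T = 1\<^sub>m m" by (auto simp: TO_def)
  have "(A * B) * (A * B)\<^sup>T = A * (B * B\<^sup>T) * A\<^sup>T"
    using A(1) B(1) by (simp add: transpose_mult assoc_mult_mat[of _ m m _ m _ m])
  then show "A \<otimes>\<^bsub>TO m\<^esub> B \<in> carrier (TO m)"
    using A B by (simp add: TO_def)
next
  fix A assume "A \<in> carrier (TO m)"
  then have A: "A \<in> carrier_mat m m" "A * A\<^sup>T = 1\<^sub>m m" by (auto simp: TO_def)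
  then have "A\<^sup>T * A = 1\<^sub>m m" using mat_mult_left_right_inverse[of A m "A\<^sup>T"] by simp
  then show "\<exists>B\<in>carrier (TO m). B \<otimes>\<^bsub>TO m\<^esub> A = \<one>\<^bsub>TO m\<^esub>"
    using A by (intro bexI[of _ "A\<^sup>T"]) (auto simp: TO_def)
qed (auto simp: TO_def assoc_mult_mat[of _ m m _ m _ m])

lemma symp_form_nondegenerate:
  assumes v: "v \<in> carrier_vec (2*r)"
    and 0: "\<And>w. w \<in> carrier_vec (2*r) \<Longrightarrow> symp_form r v w = 0"
  shows "v = 0\<^sub>v (2*r)"
proof (rule eq_vecI)
  fix k assume "k < dim_vec (0\<^sub>v (2*r) :: bit vec)"
  then have k: "k < 2*r" by simp
  then obtain j where j: "j < r" "k = 2*j \<or> k = 2*j+1"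
    by (metis Suc_eq_plus1 Suc_lessD mult_less_cancel1 oddE evenE)
  have "v $ (2*j+1) = symp_form r v (unit_vec (2*r) (2*j))"
    and "v $ (2*j) = symp_form r v (unit_vec (2*r) (2*j+1))"
  proof -
    have "(\<Sum>i<r. v $ (2*i) * unit_vec (2*r) (2*j) $ (2*i+1)
              + v $ (2*i+1) * unit_vec (2*r) (2*j) $ (2*i))
          = (\<Sum>i<r. if i = j then v $ (2*i+1) else 0)"
      using j by (intro sum.cong refl) (auto simp: unit_vec_def double_not_eq_Suc_double Suc_double_not_eq_double)
    then show "v $ (2*j+1) = symp_form r v (unit_vec (2*r) (2*j))"
      using j by (simp add: symp_form_def)
    have "(\<Sum>i<r. v $ (2*i) * unit_vec (2*r) (2*j+1) $ (2*i+1)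
              + v $ (2*i+1) * unit_vec (2*r) (2*j+1) $ (2*i))
          = (\<Sum>i<r. if i = j then v $ (2*i) else 0)"
      using j by (intro sum.cong refl) (auto simp: unit_vec_def double_not_eq_Suc_double Suc_double_not_eq_double)
    then show "v $ (2*j) = symp_form r v (unit_vec (2*r) (2*j+1))"
      using j by (simp add: symp_form_def)
  qed
  then show "v $ k = 0\<^sub>v (2*r) $ k" using j k 0 by auto
qed (use v in simp)

lemma group_Sp: "group (Sp r)"
proof (rule groupI)
  fix A assume "A \<in> carrier (Sp r)"
  then have A: "A \<in> carrier_mat (2*r) (2*r)"
    and b: "\<And>v w. v \<in> carrier_vec (2*r) \<Longrightarrow> w \<in> carrier_vec (2*r) \<Longrightarrow>
              symp_form r (A *\<^sub>v v) (A *\<^sub>v w) = symp_form r v w"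
    by (auto simp: Sp_def)
  have "det A \<noteq> 0"
  proof
    assume "det A = 0"
    then obtain v where v: "v \<in> carrier_vec (2*r)" "v \<noteq> 0\<^sub>v (2*r)" "A *\<^sub>v v = 0\<^sub>v (2*r)"
      using det_0_iff_vec_prod_zero_field[OF A] by auto
    have "symp_form r v w = 0" if "w \<in> carrier_vec (2*r)" for w
      using b[OF v(1) that] v(3) A that by (simp add: symp_form_def)
    then show False using symp_form_nondegenerate[OF v(1)] v(2) by blast
  qed
  then obtain B where B: "B \<in> carrier_mat (2*r) (2*r)"
      "B * A = 1\<^sub>m (2*r)" "A * B = 1\<^sub>m (2*r)"
    using det_non_zero_imp_unit[OF A, of undefined] by (auto simp: Units_def ring_mat_def)
  have AB: "A *\<^sub>v (B *\<^sub>v v) = v" if "v \<in> carrier_vec (2*r)" for v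
    using that A B by (simp flip: assoc_mult_mat_vec[of _ "2*r" "2*r"])
  have "symp_form r (B *\<^sub>v v) (B *\<^sub>v w) = symp_form r v w"
    if "v \<in> carrier_vec (2*r)" "w \<in> carrier_vec (2*r)" for v w
    using b[of "B *\<^sub>v v" "B *\<^sub>v w"] AB that B(1) by simp
  then show "\<exists>B\<in>carrier (Sp r). B \<otimes>\<^bsub>Sp r\<^esub> A = \<one>\<^bsub>Sp r\<^esub>"
    using B by (intro bexI[of _ B]) (auto simp: Sp_def)
qed (auto simp: Sp_def assoc_mult_mat[of _ "2*r" "2*r" _ "2*r" _ "2*r"]
      assoc_mult_mat_vec[of _ "2*r" "2*r" _ "2*r"])

lemma group_M: "group (M r)"
proof -
  have "group (monoid_vec TYPE(bit) (2*r))"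
    by (rule groupI) (auto simp: monoid_vec_def assoc_add_vec[of _ "2*r"] intro!: bexI[of _ "- _"])
  moreover have "group \<lparr>carrier = (UNIV :: bit set), mult = (+), one = 0\<rparr>"
    by (rule groupI) (auto simp: add.assoc intro: exI[of _ "- _"])
  ultimately show ?thesis unfolding M_def by (rule DirProd_group)
qed

lemma quad_form_add:
  assumes "v \<in> carrier_vec (2*r)" "w \<in> carrier_vec (2*r)"
  shows "quad_form r (v + w) = quad_form r v + quad_form r w + symp_form r v w"
proof -
  have *: "(a + b) * (c + d) = a * c + b * d + (a * d + c * b)" for a b c d :: bit
    by (simp only: distrib_left distrib_right ac_simps)
  show ?thesis
    unfolding quad_form_def symp_form_def sum.distrib[symmetric]
  proof (intro sum.cong refl)
    fix i assume "i \<in> {..<r}"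
    then have "(v + w) $ (2*i) = v $ (2*i) + w $ (2*i)"
      and "(v + w) $ (2*i+1) = v $ (2*i+1) + w $ (2*i+1)"
      using assms by (auto intro!: index_add_vec)
    then show "(v + w) $ (2*i) * (v + w) $ (2*i+1) =
        v $ (2*i) * v $ (2*i+1) + w $ (2*i) * w $ (2*i+1) +
        (v $ (2*i) * w $ (2*i+1) + v $ (2*i+1) * w $ (2*i))"
      by (simp only: *)
  qed
qed

lemma add_self_bit: "a + a = (0 :: bit)"
  by (cases a) auto

lemma Sp_quad_form_linear:
  assumes "A \<in> carrier (Sp r)" "v \<in> carrier_vec (2*r)" "w \<in> carrier_vec (2*r)"
  shows "quad_form r (v + w) + quad_form r (A *\<^sub>v (v + w)) =
    (quad_form r v + quad_form r (A *\<^sub>v v)) + (quad_form r w + quad_form r (A *\<^sub>v w))"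
proof -
  have A: "A \<in> carrier_mat (2*r) (2*r)"
    and b: "symp_form r (A *\<^sub>v v) (A *\<^sub>v w) = symp_form r v w"
    using assms by (auto simp: Sp_def)
  have "A *\<^sub>v (v + w) = A *\<^sub>v v + A *\<^sub>v w"
    using A assms by (intro mult_add_distrib_mat_vec)
  moreover have "A *\<^sub>v v \<in> carrier_vec (2*r)" "A *\<^sub>v w \<in> carrier_vec (2*r)"
    using A assms by auto
  ultimately have "quad_form r (v + w) + quad_form r (A *\<^sub>v (v + w)) =
      (quad_form r v + quad_form r w + symp_form r v w) +
      (quad_form r (A *\<^sub>v v) + quad_form r (A *\<^sub>v w) + symp_form r v w)"
    using assms b by (simp only: quad_form_add)
  also have "\<dots> = (quad_form r v + quad_form r (A *\<^sub>v v)) +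
      (quad_form r w + quad_form r (A *\<^sub>v w)) + (symp_form r v w + symp_form r v w)"
    by (simp only: ac_simps)
  finally show ?thesis by (simp only: add_self_bit add_0_right)
qed

text \<open>Over \<open>\<F>\<^sub>2\<close> an additive map is linear, so the next three facts say that
  \<^const>\<open>M_action\<close> is a linear action.\<close>

lemma M_action_hom:
  assumes "A \<in> carrier (Sp r)"
  shows "M_action r A \<in> hom (M r) (M r)"
proof (rule homI)
  have A: "A \<in> carrier_mat (2*r) (2*r)" using assms by (auto simp: Sp_def)
  fix x assume "x \<in> carrier (M r)"
  then show "M_action r A x \<in> carrier (M r)"
    using A by (auto simp: M_def M_action_def monoid_vec_def)
  fix y assume "y \<in> carrier (M r)"
  obtain v l w m where "x = (v, l)" "y = (w, m)" by (cases x, cases y)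
  then show "M_action r A (x \<otimes>\<^bsub>M r\<^esub> y) = M_action r A x \<otimes>\<^bsub>M r\<^esub> M_action r A y"
    using \<open>x \<in> _\<close> \<open>y \<in> _\<close> A Sp_quad_form_linear[OF assms, of v w]
    by (auto simp: M_def M_action_def monoid_vec_def
        mult_add_distrib_mat_vec[of _ "2*r" "2*r"] algebra_simps)
qed

lemma M_action_one:
  assumes "x \<in> carrier (M r)"
  shows "M_action r \<one>\<^bsub>Sp r\<^esub> x = x"
  using assms by (auto simp: M_def M_action_def monoid_vec_def Sp_def)

lemma M_action_mult:
  assumes "A \<in> carrier (Sp r)" "B \<in> carrier (Sp r)" "x \<in> carrier (M r)"
  shows "M_action r (A \<otimes>\<^bsub>Sp r\<^esub> B) x = M_action r A (M_action r B x)"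
  using assms
  by (auto simp: M_def M_action_def monoid_vec_def Sp_def
      assoc_mult_mat_vec[of _ "2*r" "2*r" _ "2*r"] algebra_simps)

lemma group_semidirect_product:
  assumes N: "group N" and H: "group H"
    and hom: "\<And>h. h \<in> carrier H \<Longrightarrow> \<phi> h \<in> hom N N"
    and one: "\<And>x. x \<in> carrier N \<Longrightarrow> \<phi> \<one>\<^bsub>H\<^esub> x = x"
    and mult: "\<And>g h x. g \<in> carrier H \<Longrightarrow> h \<in> carrier H \<Longrightarrow> x \<in> carrier N \<Longrightarrow>
                \<phi> (g \<otimes>\<^bsub>H\<^esub> h) x = \<phi> g (\<phi> h x)"
  shows "group (semidirect_product N \<phi> H)"
proof -
  interpret N: group N by (fact N)
  interpret H: group H by (fact H)
  have closed: "\<phi> h x \<in> carrier N" if "h \<in> carrier H" "x \<in> carrier N" for h x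
    using hom that by (auto simp: hom_def)
  have dist: "\<phi> h (x \<otimes>\<^bsub>N\<^esub> y) = \<phi> h x \<otimes>\<^bsub>N\<^esub> \<phi> h y"
    if "h \<in> carrier H" "x \<in> carrier N" "y \<in> carrier N" for h x y
    using hom that by (auto simp: hom_def)
  show ?thesis
  proof (rule groupI)
    fix p assume "p \<in> carrier (semidirect_product N \<phi> H)"
    then obtain x h where p: "p = (x, h)" "x \<in> carrier N" "h \<in> carrier H"
      by (auto simp: semidirect_product_def)
    let ?p = "(\<phi> (inv\<^bsub>H\<^esub> h) (inv\<^bsub>N\<^esub> x), inv\<^bsub>H\<^esub> h)"
    have "\<phi> (inv\<^bsub>H\<^esub> h) (inv\<^bsub>N\<^esub> x) \<otimes>\<^bsub>N\<^esub> \<phi> (inv\<^bsub>H\<^esub> h) x = \<phi> (inv\<^bsub>H\<^esub> h) \<one>\<^bsub>N\<^esub>"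
      using p by (simp flip: dist)
    also have "\<dots> = \<one>\<^bsub>N\<^esub>"
      using p hom_one[OF hom N N, of "inv\<^bsub>H\<^esub> h"] by simp
    finally show "\<exists>q\<in>carrier (semidirect_product N \<phi> H).
        q \<otimes>\<^bsub>semidirect_product N \<phi> H\<^esub> p = \<one>\<^bsub>semidirect_product N \<phi> H\<^esub>"
      using p by (intro bexI[of _ ?p]) (auto simp: semidirect_product_def closed)
  qed (auto simp: semidirect_product_def closed dist one mult N.m_assoc H.m_assoc)
qed

lemma group_M_semidirect_Sp: "group (semidirect_product (M r) (M_action r) (Sp r))"
  by (intro group_semidirect_product group_M group_Sp M_action_hom M_action_one M_action_mult)

end

(*
  Let r = n - 1, and equip F_2^(2r+2), with elements (a, s, t), with the symmetric form
    B((a,s,t), (a',s',t')) = b(a,a') + s t' + t s' + t t'.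
  It is isometric to the standard dot product, so TO(2n) is the isometry group of B.
  Since B(x,x) = t = B(x,e) for e = (0,1,0), every isometry g fixes e.  Hence
  g (0,0,1) = (u,c,1) and g (a,0,0) = (A a, sigma(a), 0), where A is symplectic and
  orthogonality of the two images forces sigma(a) = b(u, A a); conversely u, c and A are
  arbitrary.  Composition is (u,c,A)(u',c',A') = (u + A u', c + c' + b(u, A u'), A A'), and
  substituting l = c + q(u) turns the cocycle b(u, A u') into q(u') + q(A u').
*)

theory Submission
  imports Defs
begin

text \<open>By default \<open>simp\<close> turns arithmetic on \<^typ>\<open>bit\<close> into Boolean operations.\<close>

declare add_bit_eq_xor [simp del] mult_bit_eq_and [simp del]

section \<open>Isometry groups of forms on column vectors\<close>

text \<open>The form is a parameter so that one notion covers both the dot product and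
  \<open>odd_form\<close>; \<open>isometries_conj\<close> then passes between the two
  groups.\<close>

definition isometries :: "nat \<Rightarrow> ('a::field vec \<Rightarrow> 'a vec \<Rightarrow> 'a) \<Rightarrow> 'a mat monoid" where
  "isometries m \<beta> = \<lparr>carrier = {A \<in> carrier_mat m m.
       \<forall>v\<in>carrier_vec m. \<forall>w\<in>carrier_vec m. \<beta> (A *\<^sub>v v) (A *\<^sub>v w) = \<beta> v w},
     mult = (*), one = 1\<^sub>m m\<rparr>"

lemma eq_matI_vec:
  fixes A B :: "'a::semiring_1 mat"
  assumes A: "A \<in> carrier_mat nr nc" and B: "B \<in> carrier_mat nr nc"
    and eq: "\<And>v. v \<in> carrier_vec nc \<Longrightarrow> A *\<^sub>v v = B *\<^sub>v v"
  shows "A = B"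
proof (rule eq_matI)
  fix i j assume "i < dim_row B" "j < dim_col B"
  then have ij: "i < nr" "j < nc" using B by auto
  have "A $$ (i,j) = (A *\<^sub>v unit_vec nc j) $ i" using A ij by (simp add: row_def)
  also have "\<dots> = (B *\<^sub>v unit_vec nc j) $ i" using eq[of "unit_vec nc j"] by simp
  also have "\<dots> = B $$ (i,j)" using B ij by (simp add: row_def)
  finally show "A $$ (i,j) = B $$ (i,j)" .
qed (use A B in auto)

lemma zero_smult_vec_carrier:
  fixes v :: "'a::mult_zero vec"
  shows "v \<in> carrier_vec n \<Longrightarrow> 0 \<cdot>\<^sub>v v = 0\<^sub>v n"
  by auto

lemma mult_mat_vec_zero:
  "A \<in> carrier_mat nr nc \<Longrightarrow> A *\<^sub>v 0\<^sub>v nc = 0\<^sub>v nr"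
  by auto

text \<open>The entries of A^T A are the dot products of the images of the unit vectors, so
  preserving the dot product amounts to A^T A = 1. For square matrices this is equivalent to A A^T =
  1, because one-sided inverses are two-sided.\<close>

lemma TO_eq_isometries: "TO m = isometries m (\<bullet>)"
proof -
  have "A * A\<^sup>T = 1\<^sub>m m \<longleftrightarrow>
      (\<forall>v\<in>carrier_vec m. \<forall>w\<in>carrier_vec m. (A *\<^sub>v v) \<bullet> (A *\<^sub>v w) = v \<bullet> w)" (is "?l = ?r")
    if A: "A \<in> carrier_mat m m" for A :: "bit mat"
  proof
    assume ?l
    then have AA: "A\<^sup>T * A = 1\<^sub>m m"
      using mat_mult_left_right_inverse[of A m "A\<^sup>T"] A by simp
    show ?r
    proof (intro ballI)
      fix v w :: "bit vec" assume vw: "v \<in> carrier_vec m" "w \<in> carrier_vec m"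
      have "(A *\<^sub>v v) \<bullet> (A *\<^sub>v w) = (A\<^sup>T *\<^sub>v (A *\<^sub>v v)) \<bullet> w"
        using transpose_vec_mult_scalar[OF A vw(2), of "A *\<^sub>v v"] A vw by simp
      also have "A\<^sup>T *\<^sub>v (A *\<^sub>v v) = v"
        using A vw AA by (simp flip: assoc_mult_mat_vec[of _ m m _ m])
      finally show "(A *\<^sub>v v) \<bullet> (A *\<^sub>v w) = v \<bullet> w" .
    qed
  next
    assume r: ?r
    have "A\<^sup>T * A = 1\<^sub>m m"
    proof (rule eq_matI)
      fix i j assume "i < dim_row (1\<^sub>m m :: bit mat)" "j < dim_col (1\<^sub>m m :: bit mat)"
      then have ij: "i < m" "j < m" by auto
      have c: "A *\<^sub>v unit_vec m k = col A k" if "k < m" for k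
        using A that by (intro eq_vecI) (auto simp: row_def)
      have "(A\<^sup>T * A) $$ (i,j) = (A *\<^sub>v unit_vec m i) \<bullet> (A *\<^sub>v unit_vec m j)"
        using A ij c by simp
      also have "\<dots> = unit_vec m i \<bullet> unit_vec m j" using r by simp
      also have "\<dots> = (1\<^sub>m m :: bit mat) $$ (i,j)" using ij by auto
      finally show "(A\<^sup>T * A) $$ (i,j) = (1\<^sub>m m :: bit mat) $$ (i,j)" .
    qed (use A in auto)
    then show ?l using mat_mult_left_right_inverse[of "A\<^sup>T" m A] A by simp
  qed
  then show ?thesis by (auto simp: TO_def isometries_def)
qed

text \<open>A kernel vector v of A satisfies \<beta> v w = \<beta>' 0 (A w) = 0 for all w, so
  nondegeneracy forces v = 0. Allowing two different forms lets the lemma serve both the elements of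
  an isometry group and the change of basis to the dot product.\<close>

lemma isometry_inverse:
  fixes A :: "'a::field mat"
  assumes A: "A \<in> carrier_mat m m"
    and iso: "\<And>v w. v \<in> carrier_vec m \<Longrightarrow> w \<in> carrier_vec m \<Longrightarrow>
                \<beta>' (A *\<^sub>v v) (A *\<^sub>v w) = \<beta> v w"
    and nondeg: "\<And>v. v \<in> carrier_vec m \<Longrightarrow> (\<And>w. w \<in> carrier_vec m \<Longrightarrow> \<beta> v w = 0) \<Longrightarrow> v = 0\<^sub>v m"
    and zero: "\<And>w. w \<in> carrier_vec m \<Longrightarrow> \<beta>' (0\<^sub>v m) w = 0"
  obtains B where "B \<in> carrier_mat m m" "A * B = 1\<^sub>m m" "B * A = 1\<^sub>m m"
proof -
  have "det A \<noteq> 0"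
  proof
    assume "det A = 0"
    then obtain v where v: "v \<in> carrier_vec m" "v \<noteq> 0\<^sub>v m" "A *\<^sub>v v = 0\<^sub>v m"
      using det_0_iff_vec_prod_zero_field[OF A] by auto
    have "\<beta> v w = 0" if "w \<in> carrier_vec m" for w
      using iso[OF v(1) that] v(3) zero[of "A *\<^sub>v w"] A that by simp
    then show False using nondeg[OF v(1)] v(2) by blast
  qed
  \<comment> \<open>\<open>undefined\<close> only fills the extension slot of the record
    \<open>ring_mat\<close>; the matrix product does not depend on it.\<close>
  then show thesis
    using det_non_zero_imp_unit[OF A, of undefined] that by (auto simp: Units_def ring_mat_def)
qed

text \<open>Conjugation by P is the isomorphism: P carries \<beta> to \<beta>', and its inverse Q
  carries it back.\<close>

lemma isometries_conj:
  fixes P Q :: "'a::field mat"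
  assumes P: "P \<in> carrier_mat m m" and Q: "Q \<in> carrier_mat m m"
    and PQ: "P * Q = 1\<^sub>m m" and QP: "Q * P = 1\<^sub>m m"
    and iso: "\<And>v w. v \<in> carrier_vec m \<Longrightarrow> w \<in> carrier_vec m \<Longrightarrow>
                \<beta>' (P *\<^sub>v v) (P *\<^sub>v w) = \<beta> v w"
  shows "isometries m \<beta> \<cong> isometries m \<beta>'"
proof (intro is_isoI isoI homI)
  have PQv: "P *\<^sub>v (Q *\<^sub>v v) = v" and QPv: "Q *\<^sub>v (P *\<^sub>v v) = v" if "v \<in> carrier_vec m" for v
    using that P Q PQ QP by (simp_all flip: assoc_mult_mat_vec[of _ m m _ m])
  have cancel: "Q * (P * A) = A" "P * (Q * A) = A" if "A \<in> carrier_mat m m" for A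
    using that P Q PQ QP by (simp_all flip: assoc_mult_mat[of _ m m _ m _ m])
  note assoc = assoc_mult_mat[of _ m m _ m _ m] assoc_mult_mat_vec[of _ m m _ m]
  let ?f = "\<lambda>A. P * A * Q" and ?g = "\<lambda>A. Q * A * P"
  show f: "?f A \<in> carrier (isometries m \<beta>')" if "A \<in> carrier (isometries m \<beta>)" for A
  proof -
    have A: "A \<in> carrier_mat m m" using that by (simp add: isometries_def)
    have "\<beta>' (?f A *\<^sub>v v) (?f A *\<^sub>v w) = \<beta>' v w"
      if vw: "v \<in> carrier_vec m" "w \<in> carrier_vec m" for v w
    proof -
      have "\<beta>' (?f A *\<^sub>v v) (?f A *\<^sub>v w) = \<beta> (A *\<^sub>v (Q *\<^sub>v v)) (A *\<^sub>v (Q *\<^sub>v w))"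
        using vw P Q A by (simp add: assoc iso)
      also have "\<dots> = \<beta> (Q *\<^sub>v v) (Q *\<^sub>v w)"
        using vw Q \<open>A \<in> carrier (isometries m \<beta>)\<close> by (simp add: isometries_def)
      also have "\<dots> = \<beta>' v w"
        using iso[of "Q *\<^sub>v v" "Q *\<^sub>v w"] vw Q by (simp add: PQv)
      finally show ?thesis .
    qed
    then show ?thesis using A P Q by (simp add: isometries_def)
  qed
  have g: "?g A \<in> carrier (isometries m \<beta>)" if "A \<in> carrier (isometries m \<beta>')" for A
  proof -
    have A: "A \<in> carrier_mat m m" using that by (simp add: isometries_def)
    have "\<beta> (?g A *\<^sub>v v) (?g A *\<^sub>v w) = \<beta> v w"
      if vw: "v \<in> carrier_vec m" "w \<in> carrier_vec m" for v w
    proof -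
      have "\<beta> (?g A *\<^sub>v v) (?g A *\<^sub>v w) = \<beta>' (A *\<^sub>v (P *\<^sub>v v)) (A *\<^sub>v (P *\<^sub>v w))"
        using iso[of "?g A *\<^sub>v v" "?g A *\<^sub>v w"] vw P Q A by (simp add: assoc PQv)
      also have "\<dots> = \<beta>' (P *\<^sub>v v) (P *\<^sub>v w)"
        using vw P \<open>A \<in> carrier (isometries m \<beta>')\<close> by (simp add: isometries_def)
      finally show ?thesis using vw by (simp add: iso)
    qed
    then show ?thesis using A P Q by (simp add: isometries_def)
  qed
  show "?f (A \<otimes>\<^bsub>isometries m \<beta>\<^esub> B) = ?f A \<otimes>\<^bsub>isometries m \<beta>'\<^esub> ?f B"
    if "A \<in> carrier (isometries m \<beta>)" "B \<in> carrier (isometries m \<beta>)" for A B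
    using that P Q by (auto simp: isometries_def assoc cancel)
  show "bij_betw ?f (carrier (isometries m \<beta>)) (carrier (isometries m \<beta>'))"
  proof (rule bij_betw_byWitness[where f' = ?g])
    show "\<forall>A\<in>carrier (isometries m \<beta>). ?g (?f A) = A"
      and "\<forall>A\<in>carrier (isometries m \<beta>'). ?f (?g A) = A"
      using P Q PQ QP by (auto simp: isometries_def assoc cancel)
  qed (use f g in blast)+
qed

section \<open>Cancellation in characteristic 2, and matrices of additive maps\<close>

lemma add_self_bit_left: "a + (a + b) = (b :: bit)"
  by (simp add: add_self_bit flip: add.assoc)

definition mat_of_map :: "nat \<Rightarrow> nat \<Rightarrow> ('a::semiring_1 vec \<Rightarrow> 'a vec) \<Rightarrow> 'a mat" where
  "mat_of_map nr nc h = mat nr nc (\<lambda>(i,j). h (unit_vec nc j) $ i)"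

lemma mat_of_map_carrier [simp]: "mat_of_map nr nc h \<in> carrier_mat nr nc"
  by (simp add: mat_of_map_def)

text \<open>Over F_2 additivity already is linearity. The induction runs over the truncations of v
  to its first k coordinates: each step changes nothing or adds one unit vector, so scalar multiples
  never occur.\<close>

lemma mat_of_map_mult_vec:
  fixes h :: "bit vec \<Rightarrow> bit vec"
  assumes h: "\<And>v. v \<in> carrier_vec nc \<Longrightarrow> h v \<in> carrier_vec nr"
    and add: "\<And>v w. v \<in> carrier_vec nc \<Longrightarrow> w \<in> carrier_vec nc \<Longrightarrow> h (v + w) = h v + h w"
    and v: "v \<in> carrier_vec nc"
  shows "mat_of_map nr nc h *\<^sub>v v = h v"
proof (rule eq_vecI)
  fix i assume "i < dim_vec (h v)"
  then have i: "i < nr" using h[OF v] by simp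
  define trunc where "trunc k = vec nc (\<lambda>j. if j < k then v $ j else 0)" for k
  have tc: "trunc k \<in> carrier_vec nc" for k by (simp add: trunc_def)
  \<comment> \<open>Additivity at 0 + 0 makes this entry its own double, and doubles vanish in
    F_2.\<close>
  have "h (0\<^sub>v nc) $ i = h (0\<^sub>v nc) $ i + h (0\<^sub>v nc) $ i"
    using add[of "0\<^sub>v nc" "0\<^sub>v nc"] h[of "0\<^sub>v nc"] i
    by (metis carrier_vecD index_add_vec(1) left_zero_vec zero_carrier_vec)
  then have h0: "h (0\<^sub>v nc) $ i = 0" by (simp only: add_self_bit)
  have "h (trunc k) $ i = (\<Sum>j<k. h (unit_vec nc j) $ i * v $ j)" if "k \<le> nc" for k
    using that
  proof (induction k)
    case 0
    have "trunc 0 = 0\<^sub>v nc" by (auto simp: trunc_def)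
    then show ?case using h0 by simp
  next
    case (Suc k)
    show ?case
    proof (cases "v $ k = 0")
      case True
      have "trunc (Suc k) = trunc k"
        by (intro eq_vecI) (use True in \<open>auto simp: trunc_def less_Suc_eq\<close>)
      then show ?thesis using Suc True by simp
    next
      case False
      have "trunc (Suc k) = trunc k + unit_vec nc k"
        by (intro eq_vecI) (use False Suc.prems in \<open>auto simp: trunc_def less_Suc_eq\<close>)
      then show ?thesis
        using Suc False add[OF tc unit_vec_carrier, of k k] h[OF unit_vec_carrier, of k] i by simp
    qed
  qed
  from this[of nc] have "h (trunc nc) $ i = (\<Sum>j<nc. h (unit_vec nc j) $ i * v $ j)" by simp
  moreover have "trunc nc = v" using v by (intro eq_vecI) (auto simp: trunc_def)
  ultimately show "(mat_of_map nr nc h *\<^sub>v v) $ i = h v $ i"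
    using v i by (simp add: mat_of_map_def scalar_prod_def lessThan_atLeast0)
qed (use h[OF v] in \<open>simp add: mat_of_map_def\<close>)

section \<open>Bilinearity of the symplectic form\<close>

lemma symp_form_add_left:
  assumes "v \<in> carrier_vec (2*r)" "v' \<in> carrier_vec (2*r)"
  shows "symp_form r (v + v') w = symp_form r v w + symp_form r v' w"
  unfolding symp_form_def sum.distrib[symmetric]
proof (intro sum.cong refl)
  fix i assume "i \<in> {..<r}"
  then have "(v + v') $ (2*i) = v $ (2*i) + v' $ (2*i)"
    and "(v + v') $ (2*i+1) = v $ (2*i+1) + v' $ (2*i+1)"
    using assms by (auto intro!: index_add_vec)
  then show "(v + v') $ (2*i) * w $ (2*i+1) + (v + v') $ (2*i+1) * w $ (2*i) =
      v $ (2*i) * w $ (2*i+1) + v $ (2*i+1) * w $ (2*i) +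
      (v' $ (2*i) * w $ (2*i+1) + v' $ (2*i+1) * w $ (2*i))"
    by (simp only: distrib_right add_ac)
qed

lemma symp_form_commute: "symp_form r v w = symp_form r w v"
  unfolding symp_form_def by (intro sum.cong refl) (simp only: ac_simps)

lemma symp_form_add_right:
  assumes "w \<in> carrier_vec (2*r)" "w' \<in> carrier_vec (2*r)"
  shows "symp_form r v (w + w') = symp_form r v w + symp_form r v w'"
  using symp_form_add_left[OF assms] by (simp only: symp_form_commute[of r v])

lemma symp_form_self: "symp_form r v v = 0"
  unfolding symp_form_def by (rule sum.neutral) (metis add_self_bit mult.commute)

lemma symp_form_Suc:
  "symp_form (Suc r) v w =
     symp_form r v w + (v $ (2*r) * w $ Suc (2*r) + v $ Suc (2*r) * w $ (2*r))"
  by (simp add: symp_form_def)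

lemma symp_form_zero: "symp_form r (0\<^sub>v (2*r)) w = 0" "symp_form r w (0\<^sub>v (2*r)) = 0"
  by (simp_all add: symp_form_def)

section \<open>The form B on triples (a, s, t)\<close>

definition ext :: "bit vec \<Rightarrow> bit \<Rightarrow> bit \<Rightarrow> bit vec" where
  "ext a s t = a @\<^sub>v vec_of_list [s, t]"

text \<open>This is B: the pair (s, t) is treated as one more symplectic pair, and the extra product
  of last coordinates makes B(x, x) = t, so that B is not alternating.\<close>

definition odd_form :: "nat \<Rightarrow> bit vec \<Rightarrow> bit vec \<Rightarrow> bit" where
  "odd_form r x y = symp_form (Suc r) x y + x $ (2*r+1) * y $ (2*r+1)"

context
  fixes r :: nat
begin

lemma ext_carrier [simp]: "a \<in> carrier_vec (2*r) \<Longrightarrow> ext a s t \<in> carrier_vec (Suc (Suc (2*r)))"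
  by (auto simp: ext_def intro!: carrier_vecI)

lemma ext_index:
  assumes "a \<in> carrier_vec (2*r)"
  shows "i < 2*r \<Longrightarrow> ext a s t $ i = a $ i" "ext a s t $ (2*r) = s" "ext a s t $ Suc (2*r) = t"
  using assms by (auto simp: ext_def)

lemma ext_cases:
  assumes "x \<in> carrier_vec (Suc (Suc (2*r)))"
  obtains a s t where "a \<in> carrier_vec (2*r)" "x = ext a s t"
proof
  show "vec (2*r) (($) x) \<in> carrier_vec (2*r)" by simp
  show "x = ext (vec (2*r) (($) x)) (x $ (2*r)) (x $ Suc (2*r))"
  proof (rule eq_vecI)
    fix i assume "i < dim_vec (ext (vec (2*r) (($) x)) (x $ (2*r)) (x $ Suc (2*r)))"
    then consider "i < 2*r" | "i = 2*r" | "i = Suc (2*r)" by (force simp: ext_def)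
    then show "x $ i = ext (vec (2*r) (($) x)) (x $ (2*r)) (x $ Suc (2*r)) $ i"
      by cases (simp_all add: ext_index)
  qed (use assms in \<open>simp add: ext_def\<close>)
qed

lemma ext_inject:
  assumes "a \<in> carrier_vec (2*r)" "a' \<in> carrier_vec (2*r)"
  shows "ext a s t = ext a' s' t' \<longleftrightarrow> a = a' \<and> s = s' \<and> t = t'"
  using append_vec_eq[OF assms] ext_index[OF assms(1)] ext_index[OF assms(2)]
  unfolding ext_def by metis

lemma ext_add:
  assumes "a \<in> carrier_vec (2*r)" "a' \<in> carrier_vec (2*r)"
  shows "ext a s t + ext a' s' t' = ext (a + a') (s + s') (t + t')"
proof -
  have "vec_of_list [s, t] + vec_of_list [s', t'] = vec_of_list [s + s', t + t']"
    by (auto intro!: eq_vecI simp: less_Suc_eq)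
  moreover have "vec_of_list [s, t] \<in> carrier_vec 2" for s t :: bit
    by (auto intro: carrier_vecI)
  ultimately show ?thesis
    unfolding ext_def using append_vec_add[OF assms] by metis
qed

lemma ext_zero: "ext (0\<^sub>v (2*r)) 0 0 = 0\<^sub>v (Suc (Suc (2*r)))"
proof (rule eq_vecI)
  fix i assume "i < dim_vec (0\<^sub>v (Suc (Suc (2*r))) :: bit vec)"
  then consider "i < 2*r" | "i = 2*r" | "i = Suc (2*r)" by force
  then show "ext (0\<^sub>v (2*r)) 0 0 $ i = 0\<^sub>v (Suc (Suc (2*r))) $ i"
    by cases (simp_all add: ext_index)
qed (simp add: ext_def)

lemma odd_form_ext:
  assumes "a \<in> carrier_vec (2*r)" "a' \<in> carrier_vec (2*r)"
  shows "odd_form r (ext a s t) (ext a' s' t') = symp_form r a a' + (s * t' + t * s' + t * t')"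
proof -
  have "symp_form r (ext a s t) (ext a' s' t') = symp_form r a a'"
    unfolding symp_form_def using assms by (intro sum.cong) (auto simp: ext_index)
  then show ?thesis
    using assms by (simp only: odd_form_def symp_form_Suc ext_index Suc_eq_plus1[symmetric] add.assoc)
qed

text \<open>Pairing with (0, 1, 0) yields t, pairing with (0, 0, 1) then yields s, and pairing with
  the vectors (a', 0, 0) reduces the rest to nondegeneracy of \<open>symp_form\<close>.\<close>

lemma odd_form_nondegenerate:
  assumes x: "x \<in> carrier_vec (Suc (Suc (2*r)))"
    and 0: "\<And>y. y \<in> carrier_vec (Suc (Suc (2*r))) \<Longrightarrow> odd_form r x y = 0"
  shows "x = 0\<^sub>v (Suc (Suc (2*r)))"
proof -
  obtain a s t where a: "a \<in> carrier_vec (2*r)" and x: "x = ext a s t" using ext_cases[OF x] .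
  have *: "symp_form r a a' + (s * t' + t * s' + t * t') = 0"
    if "a' \<in> carrier_vec (2*r)" for a' s' t'
    using 0[OF ext_carrier[OF that]] a that by (simp add: x odd_form_ext)
  \<comment> \<open>In the fact \<open>*\<close> the variable t' occurs before s', so the values 0 1
    mean t' = 0 and s' = 1.\<close>
  have t: "t = 0" using *[of "0\<^sub>v (2*r)" 0 1] by (simp add: symp_form_zero)
  have s: "s = 0" using *[of "0\<^sub>v (2*r)" 1 0] t by (simp add: symp_form_zero)
  have "a = 0\<^sub>v (2*r)"
    using symp_form_nondegenerate[OF a] *[of _ 0 0] by simp
  then show ?thesis using x s t ext_zero by simp
qed

lemma odd_form_zero:
  "y \<in> carrier_vec (Suc (Suc (2*r))) \<Longrightarrow> odd_form r (0\<^sub>v (Suc (Suc (2*r)))) y = 0"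
  by (erule ext_cases) (simp add: odd_form_ext symp_form_zero flip: ext_zero)

section \<open>The isomorphism from the semidirect product to the isometry group of B\<close>

text \<open>The isometry with parameters u, c, A, where c = l + q(u) and \<sigma>(a) = b(u, A a).
  The shift by q(u) is what turns the cocycle of the composition law into the given action.\<close>

definition semidirect_matrix :: "(bit vec \<times> bit) \<times> bit mat \<Rightarrow> bit mat" where
  "semidirect_matrix = (\<lambda>((u, l), A). mat_of_map (Suc (Suc (2*r))) (Suc (Suc (2*r))) (\<lambda>x.
     let a = vec (2*r) (($) x); s = x $ (2*r); t = x $ Suc (2*r) in
     ext (A *\<^sub>v a + t \<cdot>\<^sub>v u) (symp_form r u (A *\<^sub>v a) + s + (l + quad_form r u) * t) t))"

lemma semidirect_matrix_carrier [simp]: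
  "semidirect_matrix p \<in> carrier_mat (Suc (Suc (2*r))) (Suc (Suc (2*r)))"
  by (auto simp: semidirect_matrix_def split: prod.split)

text \<open>The defining formula is additive in (a, s, t), so it describes the action of the matrix
  on every vector. Later arguments use this action and never the entries.\<close>

lemma semidirect_matrix_ext:
  assumes u: "u \<in> carrier_vec (2*r)" and A: "A \<in> carrier_mat (2*r) (2*r)"
    and a: "a \<in> carrier_vec (2*r)"
  shows "semidirect_matrix ((u, l), A) *\<^sub>v ext a s t =
    ext (A *\<^sub>v a + t \<cdot>\<^sub>v u) (symp_form r u (A *\<^sub>v a) + s + (l + quad_form r u) * t) t"
proof -
  define h where "h x = (let a = vec (2*r) (($) x); s = x $ (2*r); t = x $ Suc (2*r) in
     ext (A *\<^sub>v a + t \<cdot>\<^sub>v u) (symp_form r u (A *\<^sub>v a) + s + (l + quad_form r u) * t) t)" for x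
  have h: "h (ext a s t) =
      ext (A *\<^sub>v a + t \<cdot>\<^sub>v u) (symp_form r u (A *\<^sub>v a) + s + (l + quad_form r u) * t) t"
    if "a \<in> carrier_vec (2*r)" for a s t
  proof -
    have "vec (2*r) (($) (ext a s t)) = a" using that by (intro eq_vecI) (auto simp: ext_index)
    then show ?thesis using that by (simp add: h_def ext_index)
  qed
  have "h v \<in> carrier_vec (Suc (Suc (2*r)))" if v: "v \<in> carrier_vec (Suc (Suc (2*r)))" for v
    using v u A by (auto elim!: ext_cases simp: h intro!: ext_carrier)
  moreover have "h (v + w) = h v + h w"
    if v: "v \<in> carrier_vec (Suc (Suc (2*r)))" and w: "w \<in> carrier_vec (Suc (Suc (2*r)))" for v w
  proof -
    obtain a s t where v: "a \<in> carrier_vec (2*r)" "v = ext a s t" using ext_cases[OF v] .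
    obtain b s' t' where w: "b \<in> carrier_vec (2*r)" "w = ext b s' t'" using ext_cases[OF w] .
    have 1: "A *\<^sub>v a + t \<cdot>\<^sub>v u + (A *\<^sub>v b + t' \<cdot>\<^sub>v u) = A *\<^sub>v (a + b) + (t + t') \<cdot>\<^sub>v u"
      using v(1) w(1) u A
      by (intro eq_vecI) (auto simp: mult_add_distrib_mat_vec[of _ "2*r" "2*r"] algebra_simps)
    have 2: "symp_form r u (A *\<^sub>v a) + s + c * t + (symp_form r u (A *\<^sub>v b) + s' + c * t') =
        symp_form r u (A *\<^sub>v (a + b)) + (s + s') + c * (t + t')" for c
      using v(1) w(1) A
      by (simp add: mult_add_distrib_mat_vec[of _ "2*r" "2*r"] symp_form_add_right algebra_simps)
    show ?thesis
      using v w u A by (simp add: ext_add h 1 2)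
  qed
  ultimately have "mat_of_map (Suc (Suc (2*r))) (Suc (Suc (2*r))) h *\<^sub>v ext a s t = h (ext a s t)"
    using a by (intro mat_of_map_mult_vec) auto
  moreover have "semidirect_matrix ((u, l), A) = mat_of_map (Suc (Suc (2*r))) (Suc (Suc (2*r))) h"
    by (simp add: semidirect_matrix_def h_def[abs_def])
  ultimately show ?thesis using h[OF a] by simp
qed

lemma eq_matI_ext:
  fixes N N' :: "bit mat"
  assumes "N \<in> carrier_mat (Suc (Suc (2*r))) (Suc (Suc (2*r)))"
    and "N' \<in> carrier_mat (Suc (Suc (2*r))) (Suc (Suc (2*r)))"
    and "\<And>a s t. a \<in> carrier_vec (2*r) \<Longrightarrow> N *\<^sub>v ext a s t = N' *\<^sub>v ext a s t"
  shows "N = N'"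
  using assms by (metis eq_matI_vec ext_cases)

text \<open>For the isometry property, the cross terms t' b(u, A a) and t b(u, A b) arise once from
  the symplectic part and once from the middle coordinates, and c t t' arises twice; all cancel. For
  products, both sides are compared on an arbitrary triple.\<close>

lemma semidirect_matrix_hom:
  "semidirect_matrix \<in> hom (semidirect_product (M r) (M_action r) (Sp r))
     (isometries (Suc (Suc (2*r))) (odd_form r))"
proof (rule homI)
  fix p assume "p \<in> carrier (semidirect_product (M r) (M_action r) (Sp r))"
  then obtain u l A where p: "p = ((u, l), A)"
    and u: "u \<in> carrier_vec (2*r)" and ASp: "A \<in> carrier (Sp r)"
    by (auto simp: semidirect_product_def M_def monoid_vec_def)
  then have A: "A \<in> carrier_mat (2*r) (2*r)" by (simp add: Sp_def)
  have iso: "odd_form r (semidirect_matrix p *\<^sub>v v) (semidirect_matrix p *\<^sub>v w) = odd_form r v w"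
    if v: "v \<in> carrier_vec (Suc (Suc (2*r)))" and w: "w \<in> carrier_vec (Suc (Suc (2*r)))" for v w
  proof -
    obtain a s t where v: "a \<in> carrier_vec (2*r)" "v = ext a s t" using ext_cases[OF v] .
    obtain b s' t' where w: "b \<in> carrier_vec (2*r)" "w = ext b s' t'" using ext_cases[OF w] .
    have "symp_form r (A *\<^sub>v a) (A *\<^sub>v b) = symp_form r a b"
      using v w ASp by (simp add: Sp_def)
    \<comment> \<open>Splitting on t and t' reduces bilinearity to additivity; the term t t' b(u, u)
      vanishes because the form is alternating.\<close>
    moreover have
      "symp_form r (A *\<^sub>v a + t \<cdot>\<^sub>v u) (A *\<^sub>v b + t' \<cdot>\<^sub>v u) = symp_form r (A *\<^sub>v a) (A *\<^sub>v b)
        + t' * symp_form r u (A *\<^sub>v a) + t * symp_form r u (A *\<^sub>v b)"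
      using v w u A
      by (cases t; cases t')
        (simp_all add: zero_smult_vec_carrier[of _ "2*r"] symp_form_add_left symp_form_add_right symp_form_self symp_form_zero
          symp_form_commute[of r "A *\<^sub>v a" u])
    ultimately show ?thesis
      using v w u A
      by (cases t; cases t')
        (simp_all add: p semidirect_matrix_ext odd_form_ext add_ac add_self_bit add_self_bit_left)
  qed
  then show "semidirect_matrix p \<in> carrier (isometries (Suc (Suc (2*r))) (odd_form r))"
    using semidirect_matrix_carrier[of p] by (simp add: isometries_def)
  fix p' assume "p' \<in> carrier (semidirect_product (M r) (M_action r) (Sp r))"
  then obtain u' l' A' where p': "p' = ((u', l'), A')"
    and u': "u' \<in> carrier_vec (2*r)" and ASp': "A' \<in> carrier (Sp r)"
    by (auto simp: semidirect_product_def M_def monoid_vec_def)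
  then have A': "A' \<in> carrier_mat (2*r) (2*r)" by (simp add: Sp_def)
  have mult: "p \<otimes>\<^bsub>semidirect_product (M r) (M_action r) (Sp r)\<^esub> p' =
      ((u + A *\<^sub>v u', l + (quad_form r u' + quad_form r (A *\<^sub>v u') + l')), A * A')"
    by (simp add: p p' semidirect_product_def M_def monoid_vec_def M_action_def Sp_def)
  show "semidirect_matrix (p \<otimes>\<^bsub>semidirect_product (M r) (M_action r) (Sp r)\<^esub> p') =
      semidirect_matrix p \<otimes>\<^bsub>isometries (Suc (Suc (2*r))) (odd_form r)\<^esub> semidirect_matrix p'"
    (is "?L = ?R")
  proof (rule eq_matI_ext)
    show "?L \<in> carrier_mat (Suc (Suc (2*r))) (Suc (Suc (2*r)))" by (rule semidirect_matrix_carrier)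
    show "?R \<in> carrier_mat (Suc (Suc (2*r))) (Suc (Suc (2*r)))"
      using mult_carrier_mat[OF semidirect_matrix_carrier semidirect_matrix_carrier]
      by (simp add: isometries_def)
    fix a :: "bit vec" and s t assume a: "a \<in> carrier_vec (2*r)"
    define b where "b = A' *\<^sub>v a"
    have b: "b \<in> carrier_vec (2*r)" using a A' by (simp add: b_def)
    have Ab: "A *\<^sub>v b \<in> carrier_vec (2*r)" "A *\<^sub>v u' \<in> carrier_vec (2*r)"
      using A b u' by auto
    have inv: "symp_form r (A *\<^sub>v u') (A *\<^sub>v b) = symp_form r u' b"
      using ASp u' b by (simp add: Sp_def)
    have "?R *\<^sub>v ext a s t = semidirect_matrix p *\<^sub>v (semidirect_matrix p' *\<^sub>v ext a s t)"
      using assoc_mult_mat_vec[OF semidirect_matrix_carrier semidirect_matrix_carrier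
          ext_carrier[OF a], of p p' s t]
      by (simp add: isometries_def)
    also have "\<dots> = ext (A *\<^sub>v (b + t \<cdot>\<^sub>v u') + t \<cdot>\<^sub>v u)
        (symp_form r u (A *\<^sub>v (b + t \<cdot>\<^sub>v u')) + (symp_form r u' b + s + (l' + quad_form r u') * t)
          + (l + quad_form r u) * t) t"
      using a b u u' A A' by (simp add: p p' semidirect_matrix_ext flip: b_def)
    also have "A *\<^sub>v (b + t \<cdot>\<^sub>v u') + t \<cdot>\<^sub>v u = A *\<^sub>v b + t \<cdot>\<^sub>v (u + A *\<^sub>v u')"
      using b u u' A Ab
      by (intro eq_vecI) (auto simp: mult_add_distrib_mat_vec[of _ "2*r" "2*r"]
          mult_mat_vec[of _ "2*r" "2*r"] algebra_simps)
    also have "symp_form r u (A *\<^sub>v (b + t \<cdot>\<^sub>v u')) =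
        symp_form r u (A *\<^sub>v b) + t * symp_form r u (A *\<^sub>v u')"
      using b u' A Ab
      by (cases t) (simp_all add: zero_smult_vec_carrier[of _ "2*r"] mult_add_distrib_mat_vec[of _ "2*r" "2*r"]
          symp_form_add_right symp_form_zero)
    \<comment> \<open>Here the cocycle is absorbed: q(u + A u') = q(u) + q(A u') + b(u, A u'), the
      two copies of q(A u') cancel, and b(A u', A b) = b(u', b). The split on q(A u') performs that
      cancellation.\<close>
    also have "symp_form r u (A *\<^sub>v b) + t * symp_form r u (A *\<^sub>v u')
          + (symp_form r u' b + s + (l' + quad_form r u') * t) + (l + quad_form r u) * t =
        symp_form r (u + A *\<^sub>v u') (A *\<^sub>v b) + s +
          (l + (quad_form r u' + quad_form r (A *\<^sub>v u') + l') + quad_form r (u + A *\<^sub>v u')) * t"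
      using u Ab
      by (cases t; cases "quad_form r (A *\<^sub>v u')")
        (simp_all add: symp_form_add_left inv quad_form_add ac_simps)
    also have "ext (A *\<^sub>v b + t \<cdot>\<^sub>v (u + A *\<^sub>v u')) \<dots> t = ?L *\<^sub>v ext a s t"
      unfolding mult using a u u' A A' Ab
      by (simp add: semidirect_matrix_ext b_def assoc_mult_mat_vec[of _ "2*r" "2*r" _ "2*r"])
    finally show "?L *\<^sub>v ext a s t = ?R *\<^sub>v ext a s t" ..
  qed
qed

lemma semidirect_matrix_inj:
  "inj_on semidirect_matrix (carrier (semidirect_product (M r) (M_action r) (Sp r)))"
proof (rule inj_onI)
  fix p p' assume "p \<in> carrier (semidirect_product (M r) (M_action r) (Sp r))"
  then obtain u l A where p: "p = ((u, l), A)"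
    and u: "u \<in> carrier_vec (2*r)" and A: "A \<in> carrier_mat (2*r) (2*r)"
    by (auto simp: semidirect_product_def M_def monoid_vec_def Sp_def)
  assume "p' \<in> carrier (semidirect_product (M r) (M_action r) (Sp r))"
  then obtain u' l' A' where p': "p' = ((u', l'), A')"
    and u': "u' \<in> carrier_vec (2*r)" and A': "A' \<in> carrier_mat (2*r) (2*r)"
    by (auto simp: semidirect_product_def M_def monoid_vec_def Sp_def)
  assume eq: "semidirect_matrix p = semidirect_matrix p'"
  have *: "A *\<^sub>v a + t \<cdot>\<^sub>v u = A' *\<^sub>v a + t \<cdot>\<^sub>v u' \<and>
      symp_form r u (A *\<^sub>v a) + s + (l + quad_form r u) * t =
      symp_form r u' (A' *\<^sub>v a) + s + (l' + quad_form r u') * t"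
    if a: "a \<in> carrier_vec (2*r)" for a s t
    using arg_cong[OF eq, of "\<lambda>N. N *\<^sub>v ext a s t"] a u u' A A'
    by (simp add: p p' semidirect_matrix_ext ext_inject)
  have "A = A'"
  proof (rule eq_matI_vec[OF A A'])
    fix a :: "bit vec" assume "a \<in> carrier_vec (2*r)"
    then show "A *\<^sub>v a = A' *\<^sub>v a" using *[of a 0 0] u u' A A' by (simp add: zero_smult_vec_carrier[of _ "2*r"])
  qed
  \<comment> \<open>In \<open>*\<close> the variable t occurs before s, so the test vector is (0, 0,
    1): its image exhibits u and, in the next step, l + q(u).\<close>
  moreover have "u = u'" using *[of "0\<^sub>v (2*r)" 1 0] u u' A A' by (auto simp: mult_mat_vec_zero)
  moreover have "l = l'"
    using *[of "0\<^sub>v (2*r)" 1 0] calculation A A' by (auto simp: mult_mat_vec_zero)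
  ultimately show "p = p'" by (simp add: p p')
qed

text \<open>The last coordinate is intrinsic, being B(x, x), so g preserves it. This makes g fix e =
  (0, 1, 0), and u, c, A are then read off from the images of (0, 0, 1) and (a, 0, 0).\<close>

lemma semidirect_matrix_surj:
  assumes "g \<in> carrier (isometries (Suc (Suc (2*r))) (odd_form r))"
  shows "g \<in> semidirect_matrix ` carrier (semidirect_product (M r) (M_action r) (Sp r))"
proof -
  let ?m = "Suc (Suc (2*r))" and ?z = "0\<^sub>v (2*r) :: bit vec"
  have g: "g \<in> carrier_mat ?m ?m"
    and iso: "\<And>v w. v \<in> carrier_vec ?m \<Longrightarrow> w \<in> carrier_vec ?m \<Longrightarrow>
                odd_form r (g *\<^sub>v v) (g *\<^sub>v w) = odd_form r v w"
    using assms by (auto simp: isometries_def)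
  have gv: "g *\<^sub>v v \<in> carrier_vec ?m" if "v \<in> carrier_vec ?m" for v
    using g that by (rule mult_mat_vec_carrier)
  have gadd: "g *\<^sub>v (v + w) = g *\<^sub>v v + g *\<^sub>v w" if "v \<in> carrier_vec ?m" "w \<in> carrier_vec ?m" for v w
    using g that by (rule mult_add_distrib_mat_vec)
  \<comment> \<open>The inverse moves g across the form: B(g v, y) = B(v, h y).\<close>
  obtain h where h: "h \<in> carrier_mat ?m ?m" "g * h = 1\<^sub>m ?m"
    by (rule isometry_inverse[of g ?m "odd_form r" "odd_form r"])
      (use g iso odd_form_nondegenerate odd_form_zero in auto)
  have gh: "g *\<^sub>v (h *\<^sub>v v) = v" if "v \<in> carrier_vec ?m" for v
    using g h that by (simp flip: assoc_mult_mat_vec[of _ ?m ?m _ ?m])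
  have sq: "odd_form r (ext a s t) (ext a s t) = t" if "a \<in> carrier_vec (2*r)" for a s t
    using that by (cases s; cases t) (simp_all add: odd_form_ext symp_form_self)
  have last: "\<exists>b s'. b \<in> carrier_vec (2*r) \<and> g *\<^sub>v ext a s t = ext b s' t"
    if a: "a \<in> carrier_vec (2*r)" for a s t
  proof -
    obtain b s' t' where b: "b \<in> carrier_vec (2*r)" and eq: "g *\<^sub>v ext a s t = ext b s' t'"
      using ext_cases[OF gv[OF ext_carrier[OF a]]] by metis
    have "t' = t"
      using iso[OF ext_carrier[OF a] ext_carrier[OF a], of s t s t] sq a b by (simp add: eq)
    then show ?thesis using b eq by blast
  qed
  have e: "odd_form r (ext ?z 1 0) (ext a s t) = t" if "a \<in> carrier_vec (2*r)" for a s t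
    using that by (simp add: odd_form_ext symp_form_zero)
  have ge: "g *\<^sub>v ext ?z 1 0 = ext ?z 1 0"
  proof -
    obtain b s where b: "b \<in> carrier_vec (2*r)" and eq: "g *\<^sub>v ext ?z 1 0 = ext b s 0"
      using last[of ?z 1 0] by auto
    \<comment> \<open>For y = (a, s', t), B(g e, y) = B(e, h y) is the last coordinate of h y. It
      equals t, since g maps h y to y and preserves last coordinates. So g e pairs with every y as e
      does.\<close>
    have *: "symp_form r b a + s * t = t" if a: "a \<in> carrier_vec (2*r)" for a t and s' :: bit
    proof -
      have y: "ext a s' t \<in> carrier_vec ?m" using a by (rule ext_carrier)
      have hy: "h *\<^sub>v ext a s' t \<in> carrier_vec ?m" using h(1) y by (rule mult_mat_vec_carrier)
      obtain c s'' t'' where c: "c \<in> carrier_vec (2*r)" "h *\<^sub>v ext a s' t = ext c s'' t''"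
        using ext_cases[OF hy] .
      have "t'' = t"
        using last[OF c(1), of s'' t''] gh[OF y] c a ext_inject by metis
      moreover have "odd_form r (ext b s 0) (ext a s' t) = odd_form r (ext ?z 1 0) (ext c s'' t'')"
        using iso[OF ext_carrier[of ?z] hy, of 1 0] gh[OF y] c eq by simp
      ultimately show ?thesis using a b c e by (simp add: odd_form_ext)
    qed
    have "b = ?z" using symp_form_nondegenerate[OF b] *[of _ 0] by simp
    moreover have "s = 1" using *[of ?z 1] by (simp add: symp_form_zero)
    ultimately show ?thesis using eq by simp
  qed
  obtain u c where u: "u \<in> carrier_vec (2*r)" and gf: "g *\<^sub>v ext ?z 0 1 = ext u c 1"
    using last[of ?z 0 1] by auto
  obtain \<alpha> \<sigma> where \<alpha>: "\<And>a. a \<in> carrier_vec (2*r) \<Longrightarrow> \<alpha> a \<in> carrier_vec (2*r)"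
    and ga: "\<And>a. a \<in> carrier_vec (2*r) \<Longrightarrow> g *\<^sub>v ext a 0 0 = ext (\<alpha> a) (\<sigma> a) 0"
    using last[of _ 0 0] by metis
  have \<alpha>add: "\<alpha> (a + b) = \<alpha> a + \<alpha> b" if "a \<in> carrier_vec (2*r)" "b \<in> carrier_vec (2*r)" for a b
    using gadd[of "ext a 0 0" "ext b 0 0"] that \<alpha> by (simp add: ext_add ga ext_inject)
  define A where "A = mat_of_map (2*r) (2*r) \<alpha>"
  have A: "A \<in> carrier_mat (2*r) (2*r)" by (simp add: A_def)
  have A\<alpha>: "A *\<^sub>v a = \<alpha> a" if "a \<in> carrier_vec (2*r)" for a
    unfolding A_def using \<alpha> \<alpha>add that by (rule mat_of_map_mult_vec)
  have "symp_form r (\<alpha> a) (\<alpha> b) = symp_form r a b"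
    if "a \<in> carrier_vec (2*r)" "b \<in> carrier_vec (2*r)" for a b
    using iso[of "ext a 0 0" "ext b 0 0"] that \<alpha> by (simp add: ga odd_form_ext)
  then have ASp: "A \<in> carrier (Sp r)" using A A\<alpha> by (simp add: Sp_def)
  \<comment> \<open>The vectors (0, 0, 1) and (a, 0, 0) are orthogonal; for their images (u, c, 1)
    and (\<alpha> a, \<sigma> a, 0) this reads b(u, \<alpha> a) + \<sigma> a = 0.\<close>
  have \<sigma>: "\<sigma> a = symp_form r u (\<alpha> a)" if "a \<in> carrier_vec (2*r)" for a
    using iso[of "ext ?z 0 1" "ext a 0 0"] that \<alpha> u
    by (cases "\<sigma> a"; cases "symp_form r u (\<alpha> a)")
      (simp_all add: ga gf odd_form_ext symp_form_zero)
  \<comment> \<open>With l = c + q(u), the coefficient l + q(u) in \<open>semidirect_matrix\<close>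
    is c again.\<close>
  have "g = semidirect_matrix ((u, c + quad_form r u), A)"
  proof (rule eq_matI_ext[OF g semidirect_matrix_carrier])
    fix a :: "bit vec" and s t assume a: "a \<in> carrier_vec (2*r)"
    have se: "g *\<^sub>v ext ?z s 0 = ext ?z s 0"
      using ge g by (cases s) (simp_all add: ext_zero mult_mat_vec_zero zero_smult_vec_carrier[of _ "2*r"])
    have tf: "g *\<^sub>v ext ?z 0 t = ext (t \<cdot>\<^sub>v u) (c * t) t"
      using gf g u by (cases t) (simp_all add: ext_zero mult_mat_vec_zero zero_smult_vec_carrier[of _ "2*r"])
    have "ext a s t = ext a 0 0 + (ext ?z s 0 + ext ?z 0 t)" using a by (simp add: ext_add)
    then have "g *\<^sub>v ext a s t = ext (\<alpha> a) (\<sigma> a) 0 + (ext ?z s 0 + ext (t \<cdot>\<^sub>v u) (c * t) t)"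
      using a by (simp add: gadd ga se tf)
    also have "\<dots> = ext (\<alpha> a + t \<cdot>\<^sub>v u) (\<sigma> a + s + c * t) t"
      using a \<alpha> u by (simp add: ext_add add.assoc)
    also have "\<dots> = semidirect_matrix ((u, c + quad_form r u), A) *\<^sub>v ext a s t"
      using a u A by (simp add: semidirect_matrix_ext A\<alpha> \<sigma> add.assoc add_self_bit)
    finally show "g *\<^sub>v ext a s t = semidirect_matrix ((u, c + quad_form r u), A) *\<^sub>v ext a s t" .
  qed
  moreover have "((u, c + quad_form r u), A) \<in> carrier (semidirect_product (M r) (M_action r) (Sp r))"
    using u ASp by (simp add: semidirect_product_def M_def monoid_vec_def)
  ultimately show ?thesis by blast
qed

lemma semidirect_product_iso_isometries:
  "semidirect_product (M r) (M_action r) (Sp r) \<cong> isometries (Suc (Suc (2*r))) (odd_form r)"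
  using semidirect_matrix_hom semidirect_matrix_inj semidirect_matrix_surj
  by (intro is_isoI[of semidirect_matrix] isoI) (auto simp: bij_betw_def hom_def)

end

section \<open>An isometry from B to the dot product\<close>

definition partial_sum :: "nat \<Rightarrow> bit vec \<Rightarrow> nat \<Rightarrow> bit" where
  "partial_sum r x j = x $ (2*r) + (\<Sum>k<j. x $ (2*k))"

text \<open>
  With \<open>S\<^sub>j = s + x\<^sub>1 + \<dots> + x\<^sub>j\<close>, the vector \<open>[x\<^sub>1, y\<^sub>1, \<dots>, x\<^sub>r, y\<^sub>r, s, t]\<close> goes to
  \<open>[S\<^sub>0 + y\<^sub>1, S\<^sub>1 + y\<^sub>1, S\<^sub>1 + y\<^sub>2, S\<^sub>2 + y\<^sub>2, \<dots>, S\<^sub>r, s + t]\<close>.  In the dot product of two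
  images, the \<open>j\<close>-th pair contributes \<open>x\<^sub>j y'\<^sub>j + y\<^sub>j x'\<^sub>j\<close> plus a telescoping term.
\<close>

definition diag_map :: "nat \<Rightarrow> bit vec \<Rightarrow> bit vec" where
  "diag_map r x = vec (Suc (Suc (2*r))) (\<lambda>i.
     if i = Suc (2*r) then x $ (2*r) + x $ Suc (2*r)
     else partial_sum r x (Suc i div 2) + (if i = 2*r then 0 else x $ (2*(i div 2)+1)))"

lemma sum_lessThan_double:
  fixes f :: "nat \<Rightarrow> 'a::comm_monoid_add"
  shows "(\<Sum>i<2*n. f i) = (\<Sum>i<n. f (2*i) + f (2*i+1))"
  by (induction n) (simp_all add: add.assoc)

text \<open>As S j + S (Suc j) = x j, the two products of each summand add up to x j * y' j + y j *
  x' j plus S j * S' j + S (Suc j) * S' (Suc j); the inner terms of the latter cancel in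
  pairs.\<close>

lemma partial_sum_telescope:
  fixes x y :: "nat \<Rightarrow> bit"
  assumes S: "\<And>j. S (Suc j) = S j + x j" and S': "\<And>j. S' (Suc j) = S' j + x' j"
  shows "(\<Sum>j<k. (S j + y j) * (S' j + y' j) + (S (Suc j) + y j) * (S' (Suc j) + y' j)) =
    (\<Sum>j<k. x j * y' j + y j * x' j) + (S k * S' k + S 0 * S' 0)"
proof (induction k)
  case 0
  show ?case by (simp only: lessThan_0 sum.empty add_self_bit)
next
  case (Suc k)
  let ?G = "\<Sum>j<k. x j * y' j + y j * x' j" and ?X = "x k * y' k + y k * x' k"
    and ?T = "(S k + y k) * (S' k + y' k) + (S (Suc k) + y k) * (S' (Suc k) + y' k)"
  have "S k * S' k + ?T = ?X + S (Suc k) * S' (Suc k)"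
    unfolding S S'
    by (cases "S k"; cases "S' k"; cases "x k"; cases "x' k"; cases "y k"; cases "y' k") simp_all
  note step = this
  have "?G + (S k * S' k + S 0 * S' 0) + ?T = ?G + (S k * S' k + ?T) + S 0 * S' 0"
    by (simp only: add_ac)
  also have "\<dots> = ?G + ?X + (S (Suc k) * S' (Suc k) + S 0 * S' 0)"
    unfolding step by (simp only: add_ac)
  finally show ?case
    unfolding sum.lessThan_Suc Suc.IH .
qed

text \<open>The coordinate S_r cancels the upper end of the telescoping sum. Its lower end s s'
  combines with (s + t)(s' + t') to s t' + t s' + t t'.\<close>

lemma diag_map_scalar_prod:
  assumes "x \<in> carrier_vec (Suc (Suc (2*r)))" "y \<in> carrier_vec (Suc (Suc (2*r)))"
  shows "diag_map r x \<bullet> diag_map r y = odd_form r x y"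
proof -
  let ?f = "\<lambda>i. diag_map r x $ i * diag_map r y $ i" and ?S = "partial_sum r"
  have "diag_map r x \<bullet> diag_map r y = (\<Sum>i<Suc (Suc (2*r)). ?f i)"
    by (simp add: scalar_prod_def diag_map_def lessThan_atLeast0 del: sum.op_ivl_Suc)
  also have "\<dots> = (\<Sum>j<r. ?f (2*j) + ?f (2*j+1)) + (?f (2*r) + ?f (2*r+1))"
    by (simp add: sum_lessThan_double add.assoc)
  also have "(\<Sum>j<r. ?f (2*j) + ?f (2*j+1)) = (\<Sum>j<r.
      (?S x j + x $ (2*j+1)) * (?S y j + y $ (2*j+1)) +
      (?S x (Suc j) + x $ (2*j+1)) * (?S y (Suc j) + y $ (2*j+1)))"
    by (intro sum.cong refl) (auto simp: diag_map_def)
  also have "\<dots> = symp_form r x y + (?S x r * ?S y r + x $ (2*r) * y $ (2*r))"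
    using partial_sum_telescope[of "?S x" "\<lambda>j. x $ (2*j)" "?S y" "\<lambda>j. y $ (2*j)"
        "\<lambda>j. x $ (2*j+1)" "\<lambda>j. y $ (2*j+1)" r]
    by (simp add: partial_sum_def symp_form_def add.assoc)
  also have "?f (2*r) = ?S x r * ?S y r" by (simp add: diag_map_def)
  also have "?f (2*r+1) = (x $ (2*r) + x $ (2*r+1)) * (y $ (2*r) + y $ (2*r+1))"
    by (simp add: diag_map_def)
  also have "symp_form r x y + (?S x r * ?S y r + x $ (2*r) * y $ (2*r)) +
      (?S x r * ?S y r + (x $ (2*r) + x $ (2*r+1)) * (y $ (2*r) + y $ (2*r+1))) =
      symp_form r x y + (x $ (2*r) * y $ (2*r+1) + x $ (2*r+1) * y $ (2*r)) +
      x $ (2*r+1) * y $ (2*r+1)"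
    by (cases "?S x r"; cases "?S y r"; cases "x $ (2*r)"; cases "y $ (2*r)";
        cases "x $ (2*r+1)"; cases "y $ (2*r+1)") simp_all
  also have "\<dots> = odd_form r x y" by (simp add: odd_form_def symp_form_Suc)
  finally show ?thesis .
qed

lemma diag_map_add:
  assumes "x \<in> carrier_vec (Suc (Suc (2*r)))" "y \<in> carrier_vec (Suc (Suc (2*r)))"
  shows "diag_map r (x + y) = diag_map r x + diag_map r y"
proof -
  have idx: "(x + y) $ i = x $ i + y $ i" if "i < Suc (Suc (2*r))" for i using assms that by simp
  have S: "partial_sum r (x + y) j = partial_sum r x j + partial_sum r y j" if "j \<le> r" for j
  proof -
    have "(\<Sum>k<j. (x + y) $ (2*k)) = (\<Sum>k<j. x $ (2*k) + y $ (2*k))"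
      using that by (intro sum.cong refl idx) auto
    then show ?thesis by (simp add: partial_sum_def idx sum.distrib add_ac)
  qed
  show ?thesis
  proof (rule eq_vecI)
    fix i assume "i < dim_vec (diag_map r x + diag_map r y)"
    then have "i < Suc (Suc (2*r))" by (simp add: diag_map_def)
    \<comment> \<open>Separating even from odd positions lets \<open>i div 2\<close> and
      \<open>Suc i div 2\<close> evaluate, so each entry is a partial sum plus a coordinate.\<close>
    then have "i = Suc (2*r) \<or> i = 2*r \<or> (\<exists>j<r. i = 2*j) \<or> (\<exists>j<r. i = 2*j+1)"
      by presburger
    then consider "i = Suc (2*r)" | "i = 2*r" | j where "j < r" "i = 2*j" | j where "j < r" "i = 2*j+1"
      by blast
    then show "diag_map r (x + y) $ i = (diag_map r x + diag_map r y) $ i"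
      by cases (simp_all add: diag_map_def S idx add_ac)
  qed (simp add: diag_map_def)
qed

text \<open>The matrix P of \<open>diag_map\<close> carries B to the dot product. Its invertibility
  comes from nondegeneracy of B, which replaces an explicit inverse.\<close>

lemma isometries_odd_form_iso_TO: "isometries (Suc (Suc (2*r))) (odd_form r) \<cong> TO (Suc (Suc (2*r)))"
proof -
  let ?m = "Suc (Suc (2*r))"
  define P where "P = mat_of_map ?m ?m (diag_map r)"
  have P: "P \<in> carrier_mat ?m ?m" unfolding P_def by (rule mat_of_map_carrier)
  have "P *\<^sub>v x = diag_map r x" if "x \<in> carrier_vec ?m" for x
    unfolding P_def using diag_map_add that
    by (intro mat_of_map_mult_vec) (auto simp: diag_map_def)
  then have iso: "(P *\<^sub>v x) \<bullet> (P *\<^sub>v y) = odd_form r x y"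
    if "x \<in> carrier_vec ?m" "y \<in> carrier_vec ?m" for x y
    using that by (simp add: diag_map_scalar_prod)
  obtain Q where "Q \<in> carrier_mat ?m ?m" "P * Q = 1\<^sub>m ?m" "Q * P = 1\<^sub>m ?m"
    by (rule isometry_inverse[of P ?m "(\<bullet>)" "odd_form r"])
      (use P iso odd_form_nondegenerate in auto)
  then show ?thesis
    unfolding TO_eq_isometries using P iso by (intro isometries_conj[of P ?m Q])
qed

theorem corollary2p15:
  fixes n :: nat
  assumes "n \<ge> 1"
  shows "TO (2 * n) \<cong> semidirect_product (M (n - 1)) (M_action (n - 1)) (Sp (n - 1))"
proof -
  have "semidirect_product (M (n-1)) (M_action (n-1)) (Sp (n-1)) \<cong> TO (Suc (Suc (2*(n-1))))"
    by (rule iso_trans[OF semidirect_product_iso_isometries isometries_odd_form_iso_TO])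
  \<comment> \<open>The assumption on n ensures that the subtraction in n - 1 is not
    truncated.\<close>
  moreover have "Suc (Suc (2*(n-1))) = 2*n" using assms by simp
  \<comment> \<open>The isomorphism built above starts at the semidirect product; reversing it uses
    that this source is a group.\<close>
  ultimately show ?thesis
    using group.iso_sym[OF group_M_semidirect_Sp] by simp
qed

end
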